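(* Let $M,N$ be positive integers and let $A = (\alpha_{mn})$ be an $M\times N$ matrix with entries in $\mathbb{R}/\mathbb{Z}$. Then $A$ is strongly badly approximable if and only if the $N\times M$ transposed matrix $A^T$ is strongly badly approximable.
   Context: For $x \in \mathbb{R}/\mathbb{Z}$, $\|x\|$ is the distance from (any real representative of) $x$ to the nearest integer. For positive integers $M, N$, an $M\times N$ matrix $A = (\alpha_{mn})$ with entries in $\mathbb{R}/\mathbb{Z}$ is called strongly badly approximable if there exists a constant $\gamma(A) > 0$ such that $$\gamma(A) \le \left(\prod_{m=1}^M \Bigl\|\sum_{n=1}^N \alpha_{mn}\xi_n\Bigr\|\right)\left(\prod_{n=1}^N (|\xi_n|+1)\right)$$ for all $\xi \ne 0$ in $\mathbb{Z}^N$. *)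

theory Defs
  imports "HOL-Analysis.Analysis"
begin

definition cong_mod_Z :: "real \<Rightarrow> real \<Rightarrow> bool" where
  "cong_mod_Z x y \<longleftrightarrow> x - y \<in> \<int>"

lemma equivp_cong_mod_Z: "equivp cong_mod_Z"
proof (rule equivpI)
  show "reflp cong_mod_Z"
    by (simp add: reflp_def cong_mod_Z_def)
  show "symp cong_mod_Z"
    unfolding symp_def cong_mod_Z_def by (metis Ints_minus minus_diff_eq)
  show "transp cong_mod_Z"
  proof (rule transpI)
    fix x y z assume "cong_mod_Z x y" "cong_mod_Z y z"
    then have "(x - y) + (y - z) \<in> \<int>"
      unfolding cong_mod_Z_def by (rule Ints_add)
    then show "cong_mod_Z x z"
      by (simp add: cong_mod_Z_def)
  qed
qed

quotient_type RmodZ = real / cong_mod_Z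
  by (rule equivp_cong_mod_Z)

instantiation RmodZ :: ab_group_add
begin

lift_definition zero_RmodZ :: RmodZ is "0 :: real" .

lift_definition plus_RmodZ :: "RmodZ \<Rightarrow> RmodZ \<Rightarrow> RmodZ" is "(+) :: real \<Rightarrow> real \<Rightarrow> real"
  unfolding cong_mod_Z_def by (metis Ints_add add_diff_add)

lift_definition uminus_RmodZ :: "RmodZ \<Rightarrow> RmodZ" is "uminus :: real \<Rightarrow> real"
  unfolding cong_mod_Z_def by (metis Ints_minus minus_diff_minus)

lift_definition minus_RmodZ :: "RmodZ \<Rightarrow> RmodZ \<Rightarrow> RmodZ" is "(-) :: real \<Rightarrow> real \<Rightarrow> real"
proof -
  fix a b c d :: real
  assume "cong_mod_Z a b" "cong_mod_Z c d"
  then have "(a - b) - (c - d) \<in> \<int>"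
    unfolding cong_mod_Z_def by (rule Ints_diff)
  then show "cong_mod_Z (a - c) (b - d)"
    by (simp add: cong_mod_Z_def algebra_simps)
qed

instance
  by standard (transfer; simp add: cong_mod_Z_def)+

end

text \<open>\<open>\<real>/\<int>\<close> is a \<open>\<int>\<close>-module but carries no multiplication, so the products
  \<open>\<alpha>\<^sub>m\<^sub>n \<xi>\<^sub>n\<close> are integer multiples.\<close>

lift_definition int_scale :: "int \<Rightarrow> RmodZ \<Rightarrow> RmodZ" is "\<lambda>k x. of_int k * x :: real"
proof -
  fix k :: int and x y :: real
  assume "cong_mod_Z x y"
  then have "of_int k * (x - y) \<in> \<int>"
    unfolding cong_mod_Z_def by (intro Ints_mult) simp_all
  then show "cong_mod_Z (of_int k * x) (of_int k * y)"
    by (simp add: cong_mod_Z_def algebra_simps)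
qed

text \<open>\<open>of_int (round x)\<close> is an integer nearest to \<open>x\<close>, so this is the distance to \<open>\<int>\<close>
  (ties are irrelevant).\<close>

lift_definition dist_int :: "RmodZ \<Rightarrow> real" is "\<lambda>x :: real. \<bar>x - of_int (round x)\<bar>"
proof -
  fix x y :: real
  assume "cong_mod_Z x y"
  then obtain k :: int where "x - y = of_int k"
    unfolding cong_mod_Z_def by (elim Ints_cases)
  then have x: "x = y + of_int k" by simp
  have "round (y + of_int k) = round y + k"
    unfolding round_def by (metis add.assoc add.commute floor_add_int)
  then show "\<bar>x - of_int (round x)\<bar> = \<bar>y - of_int (round y)\<bar>"
    by (simp add: x)
qed

text \<open>A matrix \<open>A\<close> of type \<open>RmodZ ^ 'n ^ 'm\<close> has \<open>M = CARD('m)\<close> rows and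
  \<open>N = CARD('n)\<close> columns, with entries \<open>A $ m $ n\<close>.\<close>

definition strongly_badly_approximable :: "RmodZ ^ 'n ^ 'm \<Rightarrow> bool" where
  "strongly_badly_approximable A \<longleftrightarrow>
    (\<exists>\<gamma>::real. \<gamma> > 0 \<and>
      (\<forall>\<xi> :: int ^ 'n. \<xi> \<noteq> 0 \<longrightarrow>
        \<gamma> \<le> (\<Prod>m\<in>UNIV. dist_int (\<Sum>n\<in>UNIV. int_scale (\<xi> $ n) (A $ m $ n))) *
            (\<Prod>n\<in>UNIV. (of_int \<bar>\<xi> $ n\<bar> + 1))))"

end

theory Submission
  imports Defs
begin

text \<open>
  Let \<open>\<gamma>\<close> be a constant for \<open>A\<^sup>T\<close>, let \<open>\<xi> \<noteq> 0\<close>, \<open>X\<^sub>n = |\<xi>\<^sub>n| + 1\<close>,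
  \<open>\<delta>\<^sub>m = |(A\<xi>)\<^sub>m - p\<^sub>m|\<close>, and fix \<open>n\<^sub>0\<close> with \<open>\<xi>\<close> nonzero at \<open>n\<^sub>0\<close>. For \<open>0 < t \<le> 1\<close> and integers
  \<open>K\<^sub>m \<ge> 1\<close> with \<open>(K\<^sub>m - 1) \<delta>\<^sub>m \<le> t\<close>, the pigeonhole principle applied to the box
  \<open>0 \<le> \<eta>\<^sub>m < K\<^sub>m\<close> gives, as soon as \<open>\<Prod>K\<^sub>m\<close> exceeds \<open>B = (2/t)\<^bsup>N-1\<^esup> \<Prod>X\<^sub>n\<close>, integer vectors
  \<open>\<eta> \<noteq> 0\<close> and \<open>q\<close> with \<open>|\<eta>\<^sub>m| < K\<^sub>m\<close>, \<open>|(A\<^sup>T\<eta>)\<^sub>n - q\<^sub>n| \<le> t/X\<^sub>n\<close> for \<open>n \<noteq> n\<^sub>0\<close>, and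
  \<open>\<eta> \<cdot> p = \<xi> \<cdot> q\<close>. The last equation turns the identity
  \<open>\<eta> \<cdot> (A\<xi> - p) = \<xi> \<cdot> (A\<^sup>T\<eta> - q)\<close> into a bound of order \<open>t/X\<^sub>n\<close> at \<open>n = n\<^sub>0\<close> too. Hence
  \<open>\<gamma> \<le> c t\<^sup>N \<Prod>K\<^sub>m / \<Prod>X\<^sub>n\<close>. Halving the \<open>K\<^sub>m\<close> until \<open>\<Prod>K\<^sub>m\<close> is comparable to \<open>B\<close> this
  becomes \<open>\<gamma> \<le> c' t\<close>, which is false for a suitable constant \<open>t\<close>. So \<open>\<Prod>K\<^sub>m \<le> B\<close> for all
  admissible \<open>K\<close>, and \<open>K\<^sub>m \<approx> t/\<delta>\<^sub>m\<close> yields the lower bound for \<open>\<Prod>\<delta>\<^sub>m \<Prod>X\<^sub>n\<close>.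
\<close>

text \<open>Letting \<open>p\<close> range over all integer vectors replaces nearest integers: the
  product is smallest when every \<open>p m\<close> is nearest to its linear form. The argument can
  then use whichever integers it constructs.\<close>

definition real_sba :: "('m::finite \<Rightarrow> 'n::finite \<Rightarrow> real) \<Rightarrow> bool" where
  "real_sba a \<longleftrightarrow> (\<exists>\<gamma>>0. \<forall>\<xi> p. \<xi> \<noteq> (\<lambda>_. 0) \<longrightarrow>
     \<gamma> \<le> (\<Prod>m\<in>UNIV. \<bar>(\<Sum>n\<in>UNIV. of_int (\<xi> n) * a m n) - of_int (p m)\<bar>) *
         (\<Prod>n\<in>UNIV. of_int \<bar>\<xi> n\<bar> + 1))"

section \<open>Pigeonhole construction of integer points for the transpose\<close>

lemma prod_if_eq_else:
  fixes g :: "'n::finite \<Rightarrow> 'a::comm_monoid_mult"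
  shows "(\<Prod>n\<in>UNIV. if n = k then g n else c * g n) = c ^ (CARD('n) - 1) * (\<Prod>n\<in>UNIV. g n)"
proof -
  have "(\<Prod>n\<in>UNIV. if n = k then g n else c * g n) = (\<Prod>n\<in>UNIV. (if n = k then 1 else c) * g n)"
    by (intro prod.cong) auto
  also have "\<dots> = (\<Prod>n\<in>UNIV. if n = k then 1 else c) * (\<Prod>n\<in>UNIV. g n)"
    by (rule prod.distrib)
  also have "(\<Prod>n\<in>UNIV. if n = k then 1 else c) = (\<Prod>n\<in>UNIV - {k}. c)"
    by (rule prod.mono_neutral_cong_right) auto
  finally show ?thesis by (simp add: card_Diff_singleton)
qed

lemma abs_frac_diff_less:
  fixes x y :: real and L :: nat
  assumes "L > 0" "\<lfloor>real L * frac x\<rfloor> = \<lfloor>real L * frac y\<rfloor>"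
  shows "\<bar>(x - y) - of_int (\<lfloor>x\<rfloor> - \<lfloor>y\<rfloor>)\<bar> < 1 / real L"
proof -
  have "\<bar>real L * frac x - real L * frac y\<bar> < 1"
    using assms(2) by linarith
  moreover have "real L * frac x - real L * frac y = real L * ((x - y) - of_int (\<lfloor>x\<rfloor> - \<lfloor>y\<rfloor>))"
    by (simp add: frac_def algebra_simps)
  ultimately show ?thesis
    using assms(1) by (simp add: abs_mult pos_less_divide_eq mult.commute)
qed

text \<open>Coordinate \<open>k\<close> is not sorted by fractional part but by a residue modulo
  \<open>\<xi> k\<close>. Equal residues make the final equation solvable for an integer
  \<open>q k\<close>, at the price of only \<open>\<bar>\<xi> k\<bar>\<close> pigeonholes.\<close>

lemma dual_point_pigeonhole:
  fixes a :: "'m::finite \<Rightarrow> 'n::finite \<Rightarrow> real" and \<xi> :: "'n \<Rightarrow> int" and p :: "'m \<Rightarrow> int"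
    and K :: "'m \<Rightarrow> nat" and L :: "'n \<Rightarrow> nat"
  assumes k: "\<xi> k \<noteq> 0" and L: "\<And>n. L n > 0"
    and card: "(\<Prod>n\<in>UNIV. if n = k then nat \<bar>\<xi> k\<bar> else L n) < (\<Prod>m\<in>UNIV. K m)"
  obtains \<eta> :: "'m \<Rightarrow> int" and q :: "'n \<Rightarrow> int" where
    "\<eta> \<noteq> (\<lambda>_. 0)" "\<And>m. \<bar>\<eta> m\<bar> < int (K m)"
    "\<And>n. n \<noteq> k \<Longrightarrow> \<bar>(\<Sum>m\<in>UNIV. of_int (\<eta> m) * a m n) - of_int (q n)\<bar> < 1 / real (L n)"
    "(\<Sum>m\<in>UNIV. \<eta> m * p m) = (\<Sum>n\<in>UNIV. \<xi> n * q n)"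
proof -
  define y where "y \<eta> n = (\<Sum>m\<in>UNIV. of_int (\<eta> m) * a m n)" for \<eta> :: "'m \<Rightarrow> int" and n
  \<comment> \<open>With floors as the other entries of \<open>q\<close>, the difference of two
    values of \<open>r\<close> is what \<open>\<xi> k * q k\<close> has to equal.\<close>
  define r where "r \<eta> = (\<Sum>m\<in>UNIV. \<eta> m * p m) - (\<Sum>n\<in>UNIV - {k}. \<xi> n * \<lfloor>y \<eta> n\<rfloor>)" for \<eta>
  define f where "f \<eta> n = (if n = k then r \<eta> mod \<bar>\<xi> k\<bar> else \<lfloor>real (L n) * frac (y \<eta> n)\<rfloor>)" for \<eta> n
  define S where "S = PiE (UNIV :: 'm set) (\<lambda>m. {0..<int (K m)})"
  define T where "T = PiE (UNIV :: 'n set) (\<lambda>n. if n = k then {0..<\<bar>\<xi> k\<bar>} else {0..<int (L n)})"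
  have cardS: "card S = (\<Prod>m\<in>UNIV. K m)"
    by (simp add: S_def card_PiE)
  have cardT: "card T = (\<Prod>n\<in>UNIV. if n = k then nat \<bar>\<xi> k\<bar> else L n)"
    by (simp add: T_def card_PiE if_distrib cong: if_cong)
  have "f \<eta> \<in> T" for \<eta>
  proof -
    have "real (L n) * frac (y \<eta> n) < real (L n)" for n
      using L[of n] frac_lt_1[of "y \<eta> n"] by simp
    then have "\<lfloor>real (L n) * frac (y \<eta> n)\<rfloor> < int (L n)" for n
      by (simp add: floor_less_iff)
    then show ?thesis
      using k by (auto simp: T_def f_def)
  qed
  moreover have "finite T"
    by (auto simp: T_def intro!: finite_PiE)
  ultimately have "card (f ` S) < card S"
    using card_mono[of T "f ` S"] card cardS cardT by (metis image_subsetI le_less_trans)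
  then have "\<not> inj_on f S"
    using pigeonhole by blast
  then obtain \<eta>1 \<eta>2 where e: "\<eta>1 \<in> S" "\<eta>2 \<in> S" "\<eta>1 \<noteq> \<eta>2" "f \<eta>1 = f \<eta>2"
    unfolding inj_on_def by blast
  define \<eta> where "\<eta> m = \<eta>1 m - \<eta>2 m" for m
  have "r \<eta>1 mod \<bar>\<xi> k\<bar> = r \<eta>2 mod \<bar>\<xi> k\<bar>"
    using fun_cong[OF e(4), of k] by (simp add: f_def)
  then have "\<xi> k dvd r \<eta>1 - r \<eta>2"
    by (simp add: mod_eq_dvd_iff)
  then obtain s where s: "r \<eta>1 - r \<eta>2 = \<xi> k * s" ..
  \<comment> \<open>Differences of floors, not floors of differences, are what
    \<open>r \<eta>1 - r \<eta>2\<close> contains.\<close>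
  define q where "q n = (if n = k then s else \<lfloor>y \<eta>1 n\<rfloor> - \<lfloor>y \<eta>2 n\<rfloor>)" for n
  show ?thesis
  proof
    show "\<eta> \<noteq> (\<lambda>_. 0)"
      using e(3) by (auto simp: \<eta>_def fun_eq_iff)
    show "\<bar>\<eta> m\<bar> < int (K m)" for m
    proof -
      have "\<eta>1 m \<in> {0..<int (K m)}" "\<eta>2 m \<in> {0..<int (K m)}"
        using e(1,2) by (auto simp: S_def PiE_iff)
      then show ?thesis by (auto simp: \<eta>_def)
    qed
    show "\<bar>(\<Sum>m\<in>UNIV. of_int (\<eta> m) * a m n) - of_int (q n)\<bar> < 1 / real (L n)" if "n \<noteq> k" for n
    proof -
      have "(\<Sum>m\<in>UNIV. of_int (\<eta> m) * a m n) = y \<eta>1 n - y \<eta>2 n"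
        by (simp add: y_def \<eta>_def algebra_simps sum_subtractf)
      moreover have "\<lfloor>real (L n) * frac (y \<eta>1 n)\<rfloor> = \<lfloor>real (L n) * frac (y \<eta>2 n)\<rfloor>"
        using fun_cong[OF e(4), of n] that by (simp add: f_def)
      ultimately show ?thesis
        using abs_frac_diff_less[OF L] that by (simp add: q_def)
    qed
    have "(\<Sum>n\<in>UNIV. \<xi> n * q n) = \<xi> k * s + (\<Sum>n\<in>UNIV - {k}. \<xi> n * q n)"
      by (subst sum.remove[of _ k]) (auto simp: q_def)
    moreover have "(\<Sum>n\<in>UNIV - {k}. \<xi> n * q n) =
        (\<Sum>n\<in>UNIV - {k}. \<xi> n * \<lfloor>y \<eta>1 n\<rfloor>) - (\<Sum>n\<in>UNIV - {k}. \<xi> n * \<lfloor>y \<eta>2 n\<rfloor>)"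
      by (simp add: q_def algebra_simps sum_subtractf flip: sum_subtractf)
    moreover have "(\<Sum>m\<in>UNIV. \<eta> m * p m) = (\<Sum>m\<in>UNIV. \<eta>1 m * p m) - (\<Sum>m\<in>UNIV. \<eta>2 m * p m)"
      by (simp add: \<eta>_def left_diff_distrib sum_subtractf)
    ultimately show "(\<Sum>m\<in>UNIV. \<eta> m * p m) = (\<Sum>n\<in>UNIV. \<xi> n * q n)"
      using s unfolding r_def by linarith
  qed
qed

text \<open>The bound carries one more power of \<open>t\<close> than the box volume in
  \<open>card\<close> costs. This surplus factor \<open>t\<close> later yields the
  contradiction.\<close>

lemma dual_point:
  fixes a :: "'m::finite \<Rightarrow> 'n::finite \<Rightarrow> real" and \<xi> :: "'n \<Rightarrow> int" and p :: "'m \<Rightarrow> int"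
    and K :: "'m \<Rightarrow> nat" and t :: real
  defines "X \<equiv> \<lambda>n. real_of_int \<bar>\<xi> n\<bar> + 1"
  assumes \<xi>: "\<xi> \<noteq> (\<lambda>_. 0)" and t: "0 < t" "t \<le> 1"
    and K: "\<And>m. (real (K m) - 1) * \<bar>(\<Sum>n\<in>UNIV. of_int (\<xi> n) * a m n) - of_int (p m)\<bar> \<le> t"
    and card: "(2 / t) ^ (CARD('n) - 1) * (\<Prod>n\<in>UNIV. X n) < (\<Prod>m\<in>UNIV. real (K m))"
  obtains \<eta> :: "'m \<Rightarrow> int" and q :: "'n \<Rightarrow> int" where
    "\<eta> \<noteq> (\<lambda>_. 0)" "\<And>m. \<bar>\<eta> m\<bar> < int (K m)"
    "(\<Prod>n\<in>UNIV. \<bar>(\<Sum>m\<in>UNIV. of_int (\<eta> m) * a m n) - of_int (q n)\<bar>) \<le>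
       2 * (CARD('m) + CARD('n)) * t ^ CARD('n) / (\<Prod>n\<in>UNIV. X n)"
proof -
  obtain k where k: "\<xi> k \<noteq> 0"
    using \<xi> by auto
  have X: "X n \<ge> 1" for n
    by (simp add: X_def)
  have X0: "X n > 0" for n
    using X[of n] by linarith
  \<comment> \<open>Rounding up gives \<open>1 / L n \<le> t / X n\<close>, and costs at most a
    factor 2 because \<open>X n / t \<ge> 1\<close>.\<close>
  define L where "L n = nat \<lceil>X n / t\<rceil>" for n
  have Xt: "X n / t \<ge> 1" for n
    using X[of n] t by (simp add: field_simps)
  have L_ge: "real (L n) \<ge> X n / t" for n
    unfolding L_def by linarith
  have L_le: "real (L n) \<le> 2 / t * X n" for n
    using Xt[of n] unfolding L_def by simp linarith
  have L0: "L n > 0" for n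
    using L_ge[of n] Xt[of n] by (intro gr0I) simp
  have "real (\<Prod>n\<in>UNIV. if n = k then nat \<bar>\<xi> k\<bar> else L n) =
      (\<Prod>n\<in>UNIV. real (if n = k then nat \<bar>\<xi> k\<bar> else L n))"
    by simp
  also have "\<dots> \<le> (\<Prod>n\<in>UNIV. if n = k then X n else 2 / t * X n)"
    using L_le by (intro prod_mono) (auto simp: X_def)
  also have "\<dots> < real (\<Prod>m\<in>UNIV. K m)"
    unfolding prod_if_eq_else using card by simp
  finally have "(\<Prod>n\<in>UNIV. if n = k then nat \<bar>\<xi> k\<bar> else L n) < (\<Prod>m\<in>UNIV. K m)"
    by linarith
  from dual_point_pigeonhole[where \<xi> = \<xi> and L = L and a = a and p = p, OF k L0 this] obtain \<eta> q where
    \<eta>: "\<eta> \<noteq> (\<lambda>_. 0)" "\<And>m. \<bar>\<eta> m\<bar> < int (K m)"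
    and q: "\<And>n. n \<noteq> k \<Longrightarrow> \<bar>(\<Sum>m\<in>UNIV. of_int (\<eta> m) * a m n) - of_int (q n)\<bar> < 1 / real (L n)"
    and eq: "(\<Sum>m\<in>UNIV. \<eta> m * p m) = (\<Sum>n\<in>UNIV. \<xi> n * q n)"
    by blast
  define w where "w n = (\<Sum>m\<in>UNIV. of_int (\<eta> m) * a m n) - of_int (q n)" for n
  define z where "z m = (\<Sum>n\<in>UNIV. of_int (\<xi> n) * a m n) - of_int (p m)" for m
  have w: "\<bar>w n\<bar> \<le> t / X n" if "n \<noteq> k" for n
  proof -
    have "1 / real (L n) \<le> 1 / (X n / t)"
      using L_ge[of n] L0[of n] X0[of n] t by (intro divide_left_mono) auto
    then show ?thesis
      using q[OF that] unfolding w_def by simp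
  qed
  have "(\<Sum>m\<in>UNIV. of_int (\<eta> m) * z m) =
      (\<Sum>m\<in>UNIV. \<Sum>n\<in>UNIV. of_int (\<eta> m) * of_int (\<xi> n) * a m n) - of_int (\<Sum>m\<in>UNIV. \<eta> m * p m)"
    by (simp add: z_def algebra_simps sum_subtractf sum_distrib_left)
  also have "\<dots> = (\<Sum>n\<in>UNIV. \<Sum>m\<in>UNIV. of_int (\<eta> m) * of_int (\<xi> n) * a m n) - of_int (\<Sum>n\<in>UNIV. \<xi> n * q n)"
    unfolding eq by (subst sum.swap) simp
  also have "\<dots> = (\<Sum>n\<in>UNIV. of_int (\<xi> n) * w n)"
    by (simp add: w_def algebra_simps sum_subtractf sum_distrib_left)
  also have "\<dots> = of_int (\<xi> k) * w k + (\<Sum>n\<in>UNIV - {k}. of_int (\<xi> n) * w n)"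
    by (rule sum.remove) auto
  finally have "of_int (\<xi> k) * w k =
      (\<Sum>m\<in>UNIV. of_int (\<eta> m) * z m) - (\<Sum>n\<in>UNIV - {k}. of_int (\<xi> n) * w n)"
    by simp
  then have "\<bar>of_int (\<xi> k) * w k\<bar> \<le>
      \<bar>\<Sum>m\<in>UNIV. of_int (\<eta> m) * z m\<bar> + \<bar>\<Sum>n\<in>UNIV - {k}. of_int (\<xi> n) * w n\<bar>"
    by linarith
  also have "\<bar>\<Sum>m\<in>UNIV. of_int (\<eta> m) * z m\<bar> \<le> (\<Sum>m\<in>(UNIV::'m set). t)"
  proof (rule order_trans[OF sum_abs], rule sum_mono)
    fix m
    have "\<bar>real_of_int (\<eta> m)\<bar> \<le> real (K m) - 1"
      using \<eta>(2)[of m] by linarith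
    then have "\<bar>real_of_int (\<eta> m)\<bar> * \<bar>z m\<bar> \<le> (real (K m) - 1) * \<bar>z m\<bar>"
      by (intro mult_right_mono) auto
    then show "\<bar>of_int (\<eta> m) * z m\<bar> \<le> t"
      using K[of m] by (simp add: z_def abs_mult)
  qed
  also have "\<bar>\<Sum>n\<in>UNIV - {k}. of_int (\<xi> n) * w n\<bar> \<le> (\<Sum>n\<in>UNIV - {k}. t)"
  proof (rule order_trans[OF sum_abs], rule sum_mono)
    fix n assume "n \<in> UNIV - {k}"
    then have "\<bar>of_int (\<xi> n)\<bar> * \<bar>w n\<bar> \<le> X n * (t / X n)"
      using w[of n] by (intro mult_mono) (auto simp: X_def)
    then show "\<bar>of_int (\<xi> n) * w n\<bar> \<le> t"
      using X0[of n] by (simp add: abs_mult)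
  qed
  also have "(\<Sum>n\<in>UNIV - {k}. t) \<le> (\<Sum>n\<in>(UNIV::'n set). t)"
    using t by (intro sum_mono2) auto
  finally have "\<bar>of_int (\<xi> k)\<bar> * \<bar>w k\<bar> \<le> (CARD('m) + CARD('n)) * t"
    by (simp add: abs_mult algebra_simps)
  \<comment> \<open>A nonzero integer satisfies
    \<open>\<bar>\<xi> k\<bar> + 1 \<le> 2 * \<bar>\<xi> k\<bar>\<close>.\<close>
  moreover have "X k * \<bar>w k\<bar> \<le> 2 * \<bar>of_int (\<xi> k)\<bar> * \<bar>w k\<bar>"
    using k by (intro mult_right_mono) (auto simp: X_def)
  ultimately have "X k * \<bar>w k\<bar> \<le> 2 * (CARD('m) + CARD('n)) * t"
    by linarith
  then have wk: "\<bar>w k\<bar> \<le> 2 * (CARD('m) + CARD('n)) * (t / X k)"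
    using X0[of k] by (simp add: field_simps)
  have "(\<Prod>n\<in>UNIV. \<bar>w n\<bar>) \<le>
      (\<Prod>n\<in>UNIV. (if n = k then 2 * (CARD('m) + CARD('n)) else 1) * (t / X n))"
    using w wk by (intro prod_mono) auto
  also have "\<dots> = 2 * (CARD('m) + CARD('n)) * t ^ CARD('n) / (\<Prod>n\<in>UNIV. X n)"
    by (simp add: prod.distrib prod_dividef if_distrib[of real] cong: if_cong)
  finally show ?thesis
    using that[OF \<eta>] unfolding w_def by blast
qed

section \<open>Transference from the transpose to the matrix\<close>

lemma real_sba_transpose:
  fixes a :: "'m::finite \<Rightarrow> 'n::finite \<Rightarrow> real"
  assumes "real_sba (\<lambda>n m. a m n)"
  shows "real_sba a"
proof -
  obtain \<gamma> where \<gamma>: "\<gamma> > 0" and lower: "\<And>(\<eta> :: 'm \<Rightarrow> int) (q :: 'n \<Rightarrow> int). \<eta> \<noteq> (\<lambda>_. 0) \<Longrightarrow>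
     \<gamma> \<le> (\<Prod>n\<in>UNIV. \<bar>(\<Sum>m\<in>UNIV. of_int (\<eta> m) * a m n) - of_int (q n)\<bar>) *
         (\<Prod>m\<in>UNIV. of_int \<bar>\<eta> m\<bar> + 1)"
    using assms unfolding real_sba_def by blast
  define N where "N = CARD('n) - 1"
  have N: "CARD('n) = Suc N"
    by (simp add: N_def)
  \<comment> \<open>The factors come from \<open>dual_point\<close>, from halving every
    \<open>K m\<close>, and from \<open>(2 / t) ^ N\<close> in \<open>B\<close>.\<close>
  define C where "C = 2 * real (CARD('m) + CARD('n)) * 2 ^ CARD('m) * 2 ^ N"
  have C: "C > 0"
    by (simp add: C_def add_pos_pos)
  define t where "t = min 1 (\<gamma> / (2 * C))"
  have t: "0 < t" "t \<le> 1"
    using \<gamma> C by (auto simp: t_def)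
  have Ct: "C * t < \<gamma>"
  proof -
    have "C * t \<le> C * (\<gamma> / (2 * C))"
      using C by (intro mult_left_mono) (auto simp: t_def)
    also have "\<dots> < \<gamma>"
      using C \<gamma> by simp
    finally show ?thesis .
  qed
  have main: "t ^ CARD('m) * (t / 2) ^ N \<le>
      (\<Prod>m\<in>UNIV. \<bar>(\<Sum>n\<in>UNIV. of_int (\<xi> n) * a m n) - of_int (p m)\<bar>) * (\<Prod>n\<in>UNIV. of_int \<bar>\<xi> n\<bar> + 1)"
    if \<xi>: "\<xi> \<noteq> (\<lambda>_. 0)" for \<xi> :: "'n \<Rightarrow> int" and p :: "'m \<Rightarrow> int"
  proof -
    define X where "X = (\<Prod>n\<in>UNIV. real_of_int \<bar>\<xi> n\<bar> + 1)"
    define \<delta> where "\<delta> m = \<bar>(\<Sum>n\<in>UNIV. of_int (\<xi> n) * a m n) - of_int (p m)\<bar>" for m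
    define B where "B = (2 / t) ^ N * X"
    have X: "X \<ge> 1"
      unfolding X_def by (intro prod_ge_1) auto
    have B: "B \<ge> 1"
    proof -
      have "(2 / t) ^ N \<ge> 1"
        using t by (intro one_le_power) (auto simp: field_simps)
      then show ?thesis
        using X mult_mono[of 1 "(2 / t) ^ N" 1 X] by (simp add: B_def)
    qed
    \<comment> \<open>Descent: if the bound fails for \<open>K\<close> but holds for its half, then
      the product for \<open>K\<close> lies between \<open>B\<close> and
      \<open>2 ^ CARD('m) * B\<close>, where \<open>dual_point\<close> contradicts
      \<open>lower\<close>.\<close>
    have prod_K: "(\<Prod>m\<in>UNIV. real (K m)) \<le> B"
      if "\<And>m. K m \<ge> 1" "\<And>m. (real (K m) - 1) * \<delta> m \<le> t" for K
      using that
    proof (induction "\<Sum>m\<in>UNIV. K m" arbitrary: K rule: less_induct)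
      case less
      show ?case
      proof (rule ccontr)
        assume gt: "\<not> ?case"
        \<comment> \<open>If all \<open>K m\<close> were 1, the product would be 1, which is at most
          \<open>B\<close>.\<close>
        obtain j where j: "K j \<noteq> 1"
          using gt B by fastforce
        \<comment> \<open>Halving rounds up, so that \<open>K'\<close> stays positive and at least
          half of \<open>K\<close>.\<close>
        define K' where "K' m = (K m + 1) div 2" for m
        have K': "K' m \<ge> 1" "K' m \<le> K m" "K m \<le> 2 * K' m" for m
          using less.prems(1)[of m] by (auto simp: K'_def)
        have "(\<Prod>m\<in>UNIV. real (K' m)) \<le> B"
        proof (rule less.hyps)
          have "K' j < K j"
            using j less.prems(1)[of j] by (simp add: K'_def)
          then show "(\<Sum>m\<in>UNIV. K' m) < (\<Sum>m\<in>UNIV. K m)"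
            using K' by (intro sum_strict_mono_ex1) auto
          show "(real (K' m) - 1) * \<delta> m \<le> t" for m
          proof -
            have "(real (K' m) - 1) * \<delta> m \<le> (real (K m) - 1) * \<delta> m"
              using K'(2)[of m] by (intro mult_right_mono) (auto simp: \<delta>_def)
            then show ?thesis
              using less.prems(2)[of m] by linarith
          qed
        qed (rule K')
        moreover have "(\<Prod>m\<in>UNIV. real (K m)) \<le> (\<Prod>m\<in>UNIV. 2 * real (K' m))"
        proof (intro prod_mono conjI)
          show "real (K m) \<le> 2 * real (K' m)" for m
            using K'(3)[of m] by linarith
        qed auto
        ultimately have le: "(\<Prod>m\<in>UNIV. real (K m)) \<le> 2 ^ CARD('m) * B"
          by (simp add: prod.distrib) (erule order_trans, simp)
        have "(2 / t) ^ (CARD('n) - 1) * (\<Prod>n\<in>UNIV. real_of_int \<bar>\<xi> n\<bar> + 1) < (\<Prod>m\<in>UNIV. real (K m))"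
          using gt by (simp add: B_def X_def N_def)
        from dual_point[OF \<xi> t less.prems(2)[unfolded \<delta>_def] this] obtain \<eta> q where
          \<eta>: "\<eta> \<noteq> (\<lambda>_. 0)" "\<And>m. \<bar>\<eta> m\<bar> < int (K m)" and
          q: "(\<Prod>n\<in>UNIV. \<bar>(\<Sum>m\<in>UNIV. of_int (\<eta> m) * a m n) - of_int (q n)\<bar>) \<le>
            2 * (CARD('m) + CARD('n)) * t ^ CARD('n) / X"
          unfolding X_def by blast
        have "(\<Prod>m\<in>UNIV. real_of_int \<bar>\<eta> m\<bar> + 1) \<le> (\<Prod>m\<in>UNIV. real (K m))"
        proof (intro prod_mono conjI)
          show "real_of_int \<bar>\<eta> m\<bar> + 1 \<le> real (K m)" for m
            using \<eta>(2)[of m] by linarith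
        qed auto
        with le have \<eta>_le: "(\<Prod>m\<in>UNIV. real_of_int \<bar>\<eta> m\<bar> + 1) \<le> 2 ^ CARD('m) * B"
          by linarith
        have "\<gamma> \<le> 2 * (CARD('m) + CARD('n)) * t ^ CARD('n) / X * (2 ^ CARD('m) * B)"
        proof (rule order_trans[OF lower[OF \<eta>(1), of q] mult_mono[OF q \<eta>_le]])
          show "0 \<le> 2 * (CARD('m) + CARD('n)) * t ^ CARD('n) / X"
            using X t by simp
        qed (simp add: prod_nonneg)
        \<comment> \<open>\<open>X\<close> cancels, and \<open>t ^ Suc N\<close> against
          \<open>(2 / t) ^ N\<close> leaves \<open>2 ^ N * t\<close>.\<close>
        also have "\<dots> = C * t"
          using t X by (simp add: C_def B_def N power_divide)
        finally show False
          using Ct by linarith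
      qed
    qed
    \<comment> \<open>Adding \<open>e\<close> avoids division by a vanishing
      \<open>\<delta> m\<close>; afterwards \<open>e\<close> tends to 0 from the right.\<close>
    have "t ^ CARD('m) \<le> B * (\<Prod>m\<in>UNIV. \<delta> m + e)" if e: "e > 0" for e
    proof -
      have pos: "\<delta> m + e > 0" for m
        using e by (simp add: \<delta>_def add_nonneg_pos)
      \<comment> \<open>This choice gives both \<open>K m \<ge> t / (\<delta> m + e)\<close> and
        \<open>K m - 1 \<le> t / (\<delta> m + e)\<close>.\<close>
      define K where "K m = nat \<lfloor>t / (\<delta> m + e)\<rfloor> + 1" for m
      have nonneg: "t / (\<delta> m + e) \<ge> 0" for m
        using t pos[of m] by simp
      have "(\<Prod>m\<in>UNIV. t / (\<delta> m + e)) \<le> (\<Prod>m\<in>UNIV. real (K m))"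
      proof (intro prod_mono conjI nonneg)
        show "t / (\<delta> m + e) \<le> real (K m)" for m
          unfolding K_def by linarith
      qed
      also have "\<dots> \<le> B"
      proof (rule prod_K)
        show "(real (K m) - 1) * \<delta> m \<le> t" for m
        proof -
          have "real (K m) - 1 \<le> t / (\<delta> m + e)"
            using nonneg[of m] unfolding K_def by simp
          then have "(real (K m) - 1) * \<delta> m \<le> t / (\<delta> m + e) * (\<delta> m + e)"
            using e nonneg[of m] by (intro mult_mono) (auto simp: \<delta>_def)
          then show ?thesis
            using pos[of m] by simp
        qed
      qed (simp add: K_def)
      finally have "t ^ CARD('m) / (\<Prod>m\<in>UNIV. \<delta> m + e) \<le> B"
        by (simp add: prod_dividef)
      then show ?thesis
        using pos by (simp add: divide_le_eq prod_pos)
    qed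
    then have "\<forall>\<^sub>F e in at_right 0. t ^ CARD('m) \<le> B * (\<Prod>m\<in>UNIV. \<delta> m + e)"
      by (simp add: eventually_at_right_less eventually_at_filter)
    moreover have "((\<lambda>e. B * (\<Prod>m\<in>UNIV. \<delta> m + e)) \<longlongrightarrow> B * (\<Prod>m\<in>UNIV. \<delta> m + 0)) (at_right 0)"
      by (intro tendsto_intros)
    ultimately have "t ^ CARD('m) \<le> B * (\<Prod>m\<in>UNIV. \<delta> m)"
      using tendsto_lowerbound by fastforce
    then have "t ^ CARD('m) * (t / 2) ^ N \<le> B * (\<Prod>m\<in>UNIV. \<delta> m) * (t / 2) ^ N"
      using t by (intro mult_right_mono) auto
    also have "\<dots> = (\<Prod>m\<in>UNIV. \<delta> m) * X"
      using t by (simp add: B_def field_simps)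
    finally show ?thesis
      by (simp add: \<delta>_def X_def)
  qed
  show ?thesis
    unfolding real_sba_def using main t by (intro exI[of _ "t ^ CARD('m) * (t / 2) ^ N"]) auto
qed

section \<open>Passage between classes modulo 1 and real representatives\<close>

lemma sum_int_scale_abs_RmodZ:
  "(\<Sum>i\<in>I. int_scale (k i) (abs_RmodZ (x i))) = abs_RmodZ (\<Sum>i\<in>I. of_int (k i) * x i)"
  by (induction I rule: infinite_finite_induct)
     (simp_all add: zero_RmodZ_def int_scale.abs_eq plus_RmodZ.abs_eq)

lemma dist_int_abs_RmodZ_le: "dist_int (abs_RmodZ x) \<le> \<bar>x - of_int k\<bar>"
  by (simp add: dist_int.abs_eq round_diff_minimal)

lemma strongly_badly_approximable_iff_real_sba:
  fixes a :: "'m::finite \<Rightarrow> 'n::finite \<Rightarrow> real"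
  shows "strongly_badly_approximable (\<chi> m n. abs_RmodZ (a m n)) \<longleftrightarrow> real_sba a"
proof -
  have "(\<forall>\<xi> :: int ^ 'n. \<xi> \<noteq> 0 \<longrightarrow> \<gamma> \<le> (\<Prod>m\<in>UNIV. dist_int (abs_RmodZ (\<Sum>n\<in>UNIV. of_int (\<xi> $ n) * a m n))) *
            (\<Prod>n\<in>UNIV. (of_int \<bar>\<xi> $ n\<bar> + 1))) \<longleftrightarrow>
        (\<forall>\<xi> p. \<xi> \<noteq> (\<lambda>_. 0) \<longrightarrow>
     \<gamma> \<le> (\<Prod>m\<in>UNIV. \<bar>(\<Sum>n\<in>UNIV. of_int (\<xi> n) * a m n) - of_int (p m)\<bar>) *
         (\<Prod>n\<in>UNIV. of_int \<bar>\<xi> n\<bar> + 1))" (is "?L \<longleftrightarrow> ?R") for \<gamma>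
  proof
    assume L: ?L
    show ?R
    proof (intro allI impI)
      fix \<xi> :: "'n \<Rightarrow> int" and p :: "'m \<Rightarrow> int"
      assume "\<xi> \<noteq> (\<lambda>_. 0)"
      then have "vec_lambda \<xi> \<noteq> 0"
        by (auto simp: vec_eq_iff)
      with L have "\<gamma> \<le> (\<Prod>m\<in>UNIV. dist_int (abs_RmodZ (\<Sum>n\<in>UNIV. of_int (\<xi> n) * a m n))) *
            (\<Prod>n\<in>UNIV. (of_int \<bar>\<xi> n\<bar> + 1))"
        by (auto dest: spec[of _ "vec_lambda \<xi>"])
      also have "\<dots> \<le> (\<Prod>m\<in>UNIV. \<bar>(\<Sum>n\<in>UNIV. of_int (\<xi> n) * a m n) - of_int (p m)\<bar>) *
         (\<Prod>n\<in>UNIV. of_int \<bar>\<xi> n\<bar> + 1)"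
        using dist_int_abs_RmodZ_le
        by (intro mult_right_mono prod_mono) (auto simp: dist_int.abs_eq prod_nonneg)
      finally show "\<gamma> \<le> \<dots>" .
    qed
  next
    assume R: ?R
    show ?L
    proof (intro allI impI)
      fix \<xi> :: "int ^ 'n"
      assume "\<xi> \<noteq> 0"
      then have "($) \<xi> \<noteq> (\<lambda>_. 0)"
        by (auto simp: vec_eq_iff fun_eq_iff)
      \<comment> \<open>Here \<open>p m\<close> is the rounded value of the linear form with index
        \<open>m\<close>.\<close>
      with R show "\<gamma> \<le> (\<Prod>m\<in>UNIV. dist_int (abs_RmodZ (\<Sum>n\<in>UNIV. of_int (\<xi> $ n) * a m n))) *
            (\<Prod>n\<in>UNIV. (of_int \<bar>\<xi> $ n\<bar> + 1))"
        by (simp add: dist_int.abs_eq)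
    qed
  qed
  then show ?thesis
    by (simp add: strongly_badly_approximable_def real_sba_def sum_int_scale_abs_RmodZ)
qed

theorem theorem2p2:
  fixes A :: "RmodZ ^ 'n ^ 'm"
  shows "strongly_badly_approximable A \<longleftrightarrow> strongly_badly_approximable (transpose A)"
proof -
  define a where "a m n = rep_RmodZ (A $ m $ n)" for m n
  have A: "A = (\<chi> m n. abs_RmodZ (a m n))"
    by (simp add: a_def vec_eq_iff Quotient3_abs_rep[OF Quotient3_RmodZ])
  have "transpose A = (\<chi> n m. abs_RmodZ (a m n))"
    by (subst A) (simp add: transpose_def)
  \<comment> \<open>Both implications are instances of \<open>real_sba_transpose\<close>, for
    \<open>a\<close> and for \<open>a\<close> with its arguments swapped.\<close>
  then show ?thesis
    using A strongly_badly_approximable_iff_real_sba[of a]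
      strongly_badly_approximable_iff_real_sba[of "\<lambda>n m. a m n"]
      real_sba_transpose[of a] real_sba_transpose[of "\<lambda>n m. a m n"]
    by auto
qed

end
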